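(* Let $G=\{1_G,\alpha,\beta,\gamma\}$ be the Klein four group acting on a nonempty finite set $X$ such that every orbit has length 2. Let $p$, $q$, $r$ be the numbers of orbits on which $\alpha$, $\beta$, $\gamma$ respectively act trivially. Then there exist infinitely many $G$-bent functions on $X$ if and only if $p+q+r\le 4\min\{p,q,r\}$; moreover, if this inequality fails there is no $G$-bent function on $X$.
   Context: Let $T=\{z\in\mathbb C:|z|=1\}$. $\widehat G$ is the group of complex linear characters of $G$, $\psi_0$ the principal one. $\mathbb C^X$ has inner product $\langle f,g\rangle=\sum_x f(x)\overline{g(x)}$; $f\in\mathbb C^X$ is $\psi$-linear if $f(\delta^{-1}x)=\psi(\delta)f(x)$ for all $\delta\in G$, $x\in X$. A $G$-dual set of $X$ is a basis $\widehat X$ of $\mathbb C^X$ with $\langle\lambda,\lambda'\rangle=|X|\delta_{\lambda,\lambda'}$, each element $\psi$-linear for some $\psi\in\widehat G$, closed under complex conjugation; $\widehat X_\psi$ is its set of $\psi$-linear elements. For $f\in\mathbb C^X$, $\widehat f(\lambda)=\sum_{x\in X}f(x)\lambda(x)$. A fixed $G$-dual set $\widehat X$ is used; $f:X\to T$ is $G$-bent if $\sum_{\lambda\in\widehat X_\psi}|\widehat f(\lambda)|^2=|X|^2/|G|$ for all $\psi\in\widehat G$. (Equivalently, and independently of the choice of $\widehat X$, $f$ is $G$-bent iff for every $\delta\in G\setminus\{1_G\}$, $\sum_{x\in X}f(\delta x)f(x)^{-1}=0$.) *)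

theory Defs
  imports
    Complex_Main
    "HOL-Library.Function_Algebras"
    "HOL-Algebra.Group_Action"
    "HOL-Algebra.Elementary_Groups"
begin

definition klein_four_group :: "('a, 'm) monoid_scheme \<Rightarrow> bool" where
  "klein_four_group G \<longleftrightarrow>
     group G \<and> G \<cong> integer_mod_group 2 \<times>\<times> integer_mod_group 2"

definition complex_units :: "complex monoid" where
  "complex_units = \<lparr>carrier = UNIV - {0}, mult = (*), one = 1\<rparr>"

text \<open>Characters are made extensional so that distinct members of this set are
  distinct as functions on the carrier.\<close>
definition linear_characters :: "('a, 'm) monoid_scheme \<Rightarrow> ('a \<Rightarrow> complex) set" where
  "linear_characters G = hom G complex_units \<inter> extensional (carrier G)"

interpretation cfun: vector_space "\<lambda>(c::complex) (f::'b \<Rightarrow> complex) x. c * f x"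
  by unfold_locales (auto simp: fun_eq_iff algebra_simps)

text \<open>A complex-valued function on \<open>X\<close> is represented by its extension by zero, so that
  the functions on \<open>X\<close> form a subspace of \<^typ>\<open>'b \<Rightarrow> complex\<close>.\<close>
definition functions_on :: "'b set \<Rightarrow> ('b \<Rightarrow> complex) set" where
  "functions_on X = {f. \<forall>x. x \<notin> X \<longrightarrow> f x = 0}"

definition cinner_on :: "'b set \<Rightarrow> ('b \<Rightarrow> complex) \<Rightarrow> ('b \<Rightarrow> complex) \<Rightarrow> complex" where
  "cinner_on X f g = (\<Sum>x\<in>X. f x * cnj (g x))"

definition psi_linear ::
  "('a, 'm) monoid_scheme \<Rightarrow> 'b set \<Rightarrow> ('a \<Rightarrow> 'b \<Rightarrow> 'b) \<Rightarrow> ('a \<Rightarrow> complex) \<Rightarrow> ('b \<Rightarrow> complex) \<Rightarrow> bool"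
where
  "psi_linear G X \<phi> \<psi> f \<longleftrightarrow>
     (\<forall>\<delta>\<in>carrier G. \<forall>x\<in>X. f (\<phi> (inv\<^bsub>G\<^esub> \<delta>) x) = \<psi> \<delta> * f x)"

definition is_dual_set ::
  "('a, 'm) monoid_scheme \<Rightarrow> 'b set \<Rightarrow> ('a \<Rightarrow> 'b \<Rightarrow> 'b) \<Rightarrow> ('b \<Rightarrow> complex) set \<Rightarrow> bool"
where
  "is_dual_set G X \<phi> D \<longleftrightarrow>
     cfun.independent D \<and> cfun.span D = functions_on X \<and>
     (\<forall>l\<in>D. \<forall>l'\<in>D. cinner_on X l l' = (if l = l' then of_nat (card X) else 0)) \<and>
     (\<forall>l\<in>D. \<exists>\<psi>\<in>linear_characters G. psi_linear G X \<phi> \<psi> l) \<and>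
     (\<forall>l\<in>D. (\<lambda>x. cnj (l x)) \<in> D)"

definition dual_part ::
  "('a, 'm) monoid_scheme \<Rightarrow> 'b set \<Rightarrow> ('a \<Rightarrow> 'b \<Rightarrow> 'b) \<Rightarrow> ('b \<Rightarrow> complex) set \<Rightarrow> ('a \<Rightarrow> complex) \<Rightarrow> ('b \<Rightarrow> complex) set"
where
  "dual_part G X \<phi> D \<psi> = {l \<in> D. psi_linear G X \<phi> \<psi> l}"

definition fourier :: "'b set \<Rightarrow> ('b \<Rightarrow> complex) \<Rightarrow> ('b \<Rightarrow> complex) \<Rightarrow> complex" where
  "fourier X f l = (\<Sum>x\<in>X. f x * l x)"

definition bent ::
  "('a, 'm) monoid_scheme \<Rightarrow> 'b set \<Rightarrow> ('a \<Rightarrow> 'b \<Rightarrow> 'b) \<Rightarrow> ('b \<Rightarrow> complex) set \<Rightarrow> ('b \<Rightarrow> complex) \<Rightarrow> bool"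
where
  "bent G X \<phi> D f \<longleftrightarrow>
     f \<in> functions_on X \<and> (\<forall>x\<in>X. cmod (f x) = 1) \<and>
     (\<forall>\<psi>\<in>linear_characters G.
        (\<Sum>l\<in>dual_part G X \<phi> D \<psi>. (cmod (fourier X f l))\<^sup>2)
          = (real (card X))\<^sup>2 / real (order G))"

definition num_trivial_orbits ::
  "('a, 'm) monoid_scheme \<Rightarrow> 'b set \<Rightarrow> ('a \<Rightarrow> 'b \<Rightarrow> 'b) \<Rightarrow> 'a \<Rightarrow> nat"
where
  "num_trivial_orbits G X \<phi> g = card {U \<in> orbits G X \<phi>. \<forall>x\<in>U. \<phi> g x = x}"

end

theory Submission
  imports Defs
begin

text \<open>
  Expanding \<open>f\<close> in the dual set, whose members are eigenvectors of the action, expresses the energy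
  of \<open>f\<close> on the \<open>\<psi>\<close>-part as \<open>|X|/4\<close> times \<open>\<Sum>\<^sub>g \<psi>(g) A(g)\<close>, where \<open>A(g)\<close> is the autocorrelation of
  \<open>f\<close> under \<open>g\<close>. Hence \<open>f\<close> is bent iff \<open>A\<close> vanishes at \<open>\<alpha>\<close>, \<open>\<beta>\<close> and \<open>\<gamma>\<close>.
  On an orbit \<open>{x, y}\<close> exactly one of \<open>\<alpha>, \<beta>, \<gamma>\<close> is trivial and contributes \<open>2\<close> to its
  autocorrelation; the other two swap \<open>x\<close> and \<open>y\<close> and contribute \<open>2 Re (f x * cnj (f y))\<close>, which
  takes any prescribed value in \<open>[-2, 2]\<close>. If \<open>S\<^sub>p, S\<^sub>q, S\<^sub>r\<close> are the sums of these real parts over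
  the three kinds of orbits, bentness is the linear system
  \<open>p + S\<^sub>q + S\<^sub>r = S\<^sub>p + q + S\<^sub>r = S\<^sub>p + S\<^sub>q + r = 0\<close>, whose only solution has
  \<open>S\<^sub>p = (p - q - r)/2\<close> etc.; it is attainable iff \<open>|S\<^sub>p| \<le> p\<close> etc., which is the stated inequality.
  Multiplying a bent function by unit scalars yields infinitely many.
\<close>

section \<open>Order and squares in the Klein four group\<close>

lemma klein_four_group_order:
  assumes "klein_four_group G"
  shows "order G = 4"
proof -
  obtain h where "h \<in> iso G (integer_mod_group 2 \<times>\<times> integer_mod_group 2)"
    using assms by (auto simp: klein_four_group_def is_iso_def)
  hence "bij_betw h (carrier G) (carrier (integer_mod_group 2 \<times>\<times> integer_mod_group 2))"
    by (simp add: iso_def)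
  hence "card (carrier G) = card ({0..<2::int} \<times> {0..<2::int})"
    using bij_betw_same_card by (fastforce simp: carrier_integer_mod_group)
  thus ?thesis by (simp add: order_def)
qed

lemma klein_four_group_square:
  assumes "klein_four_group G" "x \<in> carrier G"
  shows "x \<otimes>\<^bsub>G\<^esub> x = \<one>\<^bsub>G\<^esub>"
proof -
  let ?K = "integer_mod_group 2 \<times>\<times> integer_mod_group 2"
  interpret G: group G using assms(1) by (simp add: klein_four_group_def)
  interpret K: group ?K by (intro DirProd_group) auto
  obtain h where h: "h \<in> iso G ?K"
    using assms(1) by (auto simp: klein_four_group_def is_iso_def)
  hence hom: "h \<in> hom G ?K" and inj: "inj_on h (carrier G)"
    by (auto simp: iso_def bij_betw_def)
  interpret group_hom G ?K h using hom by unfold_locales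
  have "y \<otimes>\<^bsub>?K\<^esub> y = \<one>\<^bsub>?K\<^esub>" for y
    by (cases y) (auto simp: mult_2[symmetric])
  hence "h (x \<otimes>\<^bsub>G\<^esub> x) = h \<one>\<^bsub>G\<^esub>" using assms(2) by simp
  thus ?thesis using inj_onD[OF inj] assms(2) by blast
qed

section \<open>Orthogonal expansions and autocorrelation\<close>

lemma sum_fun_apply: "(\<Sum>i\<in>I. h i) x = (\<Sum>i\<in>I. (h i x :: 'c :: comm_monoid_add))"
  by (induction I rule: infinite_finite_induct) auto

text \<open>The finitely many point indicators span the functions on \<open>X\<close>, which bounds
  the size of an independent set. Sums over a dual set are meaningful only once it is known to be
  finite.\<close>

lemma finite_independent_functions_on:
  fixes D :: "('b \<Rightarrow> complex) set"
  assumes "finite X" "cfun.independent D" "D \<subseteq> functions_on X"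
  shows "finite D"
proof -
  let ?e = "\<lambda>x y. if y = x then 1 else 0 :: complex"
  have "f \<in> cfun.span (?e ` X)" if "f \<in> functions_on X" for f :: "'b \<Rightarrow> complex"
  proof -
    have "f = (\<Sum>x\<in>X. (\<lambda>y. f x * ?e x y))"
    proof
      fix y
      have "(\<Sum>x\<in>X. (\<lambda>y. f x * ?e x y)) y = (\<Sum>x\<in>X. f x * ?e x y)"
        by (simp add: sum_fun_apply)
      also have "\<dots> = f y"
        using assms(1) that by (auto simp: functions_on_def if_distrib cong: if_cong)
      finally show "f y = (\<Sum>x\<in>X. (\<lambda>y. f x * ?e x y)) y" by simp
    qed
    moreover have "(\<Sum>x\<in>X. (\<lambda>y. f x * ?e x y)) \<in> cfun.span (?e ` X)"
      by (intro cfun.span_sum cfun.span_scale cfun.span_base) auto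
    ultimately show ?thesis by simp
  qed
  thus ?thesis
    using cfun.independent_span_bound[of "?e ` X" D] assms by blast
qed

text \<open>Pairing a linear combination that represents \<open>f\<close> with \<open>l\<close>
  isolates the coefficient of \<open>l\<close>. The identity holds at every point, in
  \<open>X\<close> or outside it, so it may be evaluated at \<open>\<sigma> x\<close> without
  knowing where \<open>\<sigma>\<close> sends \<open>x\<close>.\<close>

lemma orthogonal_expansion:
  fixes D :: "('b \<Rightarrow> complex) set"
  assumes "finite D" "f \<in> cfun.span D" "n \<noteq> 0"
    and orth: "\<And>l l'. l \<in> D \<Longrightarrow> l' \<in> D \<Longrightarrow> cinner_on X l l' = (if l = l' then n else 0)"
  shows "f x = (\<Sum>l\<in>D. cinner_on X f l / n * l x)"
proof -
  obtain u where u: "f = (\<Sum>l\<in>D. (\<lambda>x. u l * l x))"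
    using assms(1,2) by (auto simp: cfun.span_finite)
  hence fx: "f x = (\<Sum>l\<in>D. u l * l x)" for x by (simp add: sum_fun_apply)
  have "cinner_on X f l = n * u l" if "l \<in> D" for l
  proof -
    have "cinner_on X f l = (\<Sum>x\<in>X. \<Sum>m\<in>D. u m * (m x * cnj (l x)))"
      by (simp add: cinner_on_def fx sum_distrib_right mult.assoc)
    also have "\<dots> = (\<Sum>m\<in>D. u m * cinner_on X m l)"
      by (subst sum.swap) (simp add: cinner_on_def sum_distrib_left)
    also have "\<dots> = (\<Sum>m\<in>D. if m = l then u m * n else 0)"
      using that by (intro sum.cong) (auto simp: orth)
    finally show ?thesis using assms(1) that by simp
  qed
  thus ?thesis using assms(3) by (simp add: fx)
qed

text \<open>The domain is a parameter so that the same sum can also be taken over a single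
  orbit.\<close>

definition autocorrelation :: "'b set \<Rightarrow> ('b \<Rightarrow> 'b) \<Rightarrow> ('b \<Rightarrow> complex) \<Rightarrow> complex" where
  "autocorrelation X \<sigma> f = (\<Sum>x\<in>X. f (\<sigma> x) * cnj (f x))"

text \<open>Composition with \<open>\<sigma>\<close> multiplies the coefficient at \<open>l\<close>
  by \<open>c l\<close>; the claim is then Parseval's identity for the pairing of the shifted
  \<open>f\<close> with \<open>f\<close>.\<close>

lemma autocorrelation_eigenbasis:
  fixes D :: "('b \<Rightarrow> complex) set"
  assumes "finite D" "f \<in> cfun.span D" "n \<noteq> 0"
    and orth: "\<And>l l'. l \<in> D \<Longrightarrow> l' \<in> D \<Longrightarrow> cinner_on X l l' = (if l = l' then n else 0)"
    and eigen: "\<And>l x. l \<in> D \<Longrightarrow> x \<in> X \<Longrightarrow> l (\<sigma> x) = c l * l x"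
  shows "n * autocorrelation X \<sigma> f = (\<Sum>l\<in>D. c l * of_real ((cmod (cinner_on X f l))\<^sup>2))"
proof -
  let ?a = "\<lambda>l. cinner_on X f l"
  have "f (\<sigma> x) = (\<Sum>l\<in>D. ?a l / n * (c l * l x))" if "x \<in> X" for x
    using orthogonal_expansion[OF assms(1-4), of "\<sigma> x"] eigen that by simp
  hence "n * autocorrelation X \<sigma> f
      = n * (\<Sum>x\<in>X. \<Sum>l\<in>D. ?a l / n * c l * (l x * cnj (f x)))"
    by (simp add: autocorrelation_def sum_distrib_right mult.assoc)
  also have "\<dots> = n * (\<Sum>l\<in>D. ?a l / n * c l * (\<Sum>x\<in>X. l x * cnj (f x)))"
    by (subst sum.swap) (simp add: sum_distrib_left)
  also have "\<dots> = (\<Sum>l\<in>D. c l * (?a l * (\<Sum>x\<in>X. l x * cnj (f x))))"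
    using assms(3) by (subst sum_distrib_left) (simp add: mult_ac)
  also have "\<dots> = (\<Sum>l\<in>D. c l * (?a l * cnj (?a l)))"
    by (simp add: cinner_on_def mult.commute)
  finally show ?thesis by (simp only: complex_norm_square)
qed

lemma Re_mult_cnj_bound:
  assumes "cmod z = 1" "cmod w = 1"
  shows "\<bar>Re (z * cnj w)\<bar> \<le> 1"
  using abs_Re_le_cmod[of "z * cnj w"] assms by (simp add: norm_mult)

section \<open>The group law on the four named elements\<close>

locale klein_four_action = group_action G X \<phi>
  for G :: "('a, 'm) monoid_scheme" (structure) and X :: "'b set" and \<phi> +
  fixes \<alpha> \<beta> \<gamma>
  assumes klein: "klein_four_group G"
    and carrier_eq: "carrier G = {\<one>, \<alpha>, \<beta>, \<gamma>}"
    and finite_X: "finite X"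
    and X_nonempty: "X \<noteq> {}"
    and card_orbit: "\<And>U. U \<in> orbits G X \<phi> \<Longrightarrow> card U = 2"
begin

sublocale group G
  using klein by (simp add: klein_four_group_def)

text \<open>A list of length four that enumerates a set of four elements has no repetitions.\<close>

lemma distinct_carrier: "distinct [\<one>, \<alpha>, \<beta>, \<gamma>]"
proof -
  have "card (set [\<one>, \<alpha>, \<beta>, \<gamma>]) = length [\<one>, \<alpha>, \<beta>, \<gamma>]"
    using klein_four_group_order[OF klein] by (simp add: order_def carrier_eq)
  thus ?thesis by (rule card_distinct)
qed

lemma mem_carrier [simp]: "\<alpha> \<in> carrier G" "\<beta> \<in> carrier G" "\<gamma> \<in> carrier G"
  by (auto simp: carrier_eq)

lemma square [simp]: "x \<in> carrier G \<Longrightarrow> x \<otimes> x = \<one>"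
  by (rule klein_four_group_square[OF klein])

lemma inv_self [simp]: "x \<in> carrier G \<Longrightarrow> inv x = x"
  by (simp add: inv_equality)

lemma alpha_beta: "\<alpha> \<otimes> \<beta> = \<gamma>"
proof -
  have "\<alpha> \<otimes> \<beta> \<in> {\<one>, \<alpha>, \<beta>, \<gamma>}" using carrier_eq m_closed mem_carrier by blast
  moreover have "\<alpha> \<otimes> \<beta> \<noteq> \<alpha>" "\<alpha> \<otimes> \<beta> \<noteq> \<beta>"
    using distinct_carrier r_cancel_one[of \<beta> \<alpha>] l_cancel_one[of \<alpha> \<beta>] by auto
  \<comment> \<open>Otherwise \<alpha> would be the inverse of \<beta>, which is \<beta>
    itself.\<close>
  moreover have "\<alpha> \<otimes> \<beta> \<noteq> \<one>"
    using distinct_carrier inv_equality[of \<alpha> \<beta>] by auto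
  ultimately show ?thesis by blast
qed

lemma commute: "x \<in> carrier G \<Longrightarrow> y \<in> carrier G \<Longrightarrow> x \<otimes> y = y \<otimes> x"
  by (metis inv_mult_group inv_self m_closed)

lemma multiplication_table:
  "\<alpha> \<otimes> \<beta> = \<gamma>" "\<beta> \<otimes> \<alpha> = \<gamma>" "\<alpha> \<otimes> \<gamma> = \<beta>" "\<gamma> \<otimes> \<alpha> = \<beta>" "\<beta> \<otimes> \<gamma> = \<alpha>" "\<gamma> \<otimes> \<beta> = \<alpha>"
proof -
  show 1: "\<alpha> \<otimes> \<beta> = \<gamma>" by (rule alpha_beta)
  show 2: "\<beta> \<otimes> \<alpha> = \<gamma>" using 1 commute by simp
  show 3: "\<alpha> \<otimes> \<gamma> = \<beta>" using 1 m_assoc[of \<alpha> \<alpha> \<beta>] by simp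
  show "\<gamma> \<otimes> \<alpha> = \<beta>" using 3 commute by simp
  show 4: "\<beta> \<otimes> \<gamma> = \<alpha>" using 2 m_assoc[of \<beta> \<beta> \<alpha>] by simp
  show "\<gamma> \<otimes> \<beta> = \<alpha>" using 4 commute by simp
qed

lemma sum_carrier: "(\<Sum>g\<in>carrier G. h g) = h \<one> + h \<alpha> + h \<beta> + (h \<gamma> :: complex)"
  using distinct_carrier by (simp add: carrier_eq add.assoc)

lemma action_one: "x \<in> X \<Longrightarrow> \<phi> \<one> x = x"
  using id_eq_one by (metis restrict_apply')

section \<open>Characters of the Klein four group\<close>

lemma character_mult:
  "\<psi> \<in> linear_characters G \<Longrightarrow> x \<in> carrier G \<Longrightarrow> y \<in> carrier G \<Longrightarrow> \<psi> (x \<otimes> y) = \<psi> x * \<psi> y"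
  by (auto simp: linear_characters_def hom_def complex_units_def)

lemma character_nonzero: "\<psi> \<in> linear_characters G \<Longrightarrow> x \<in> carrier G \<Longrightarrow> \<psi> x \<noteq> 0"
  by (auto simp: linear_characters_def hom_def complex_units_def)

lemma character_one: "\<psi> \<in> linear_characters G \<Longrightarrow> \<psi> \<one> = 1"
  using character_mult[of \<psi> \<one> \<one>] character_nonzero[of \<psi> \<one>] by simp

text \<open>Every element squares to one, so characters are real valued. This is why the
  orthogonality relation below carries no conjugates.\<close>

lemma character_cases:
  assumes "\<psi> \<in> linear_characters G" "x \<in> carrier G"
  shows "\<psi> x = 1 \<or> \<psi> x = -1"
proof -
  have "\<psi> x * \<psi> x = 1"
    using character_mult[OF assms assms(2)] character_one[OF assms(1)] assms(2) by simp
  thus ?thesis by (metis square_eq_1_iff)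
qed

lemma character_gamma: "\<psi> \<in> linear_characters G \<Longrightarrow> \<psi> \<gamma> = \<psi> \<alpha> * \<psi> \<beta>"
  using character_mult[of \<psi> \<alpha> \<beta>] by (simp add: multiplication_table)

lemma character_eqI:
  assumes "\<psi> \<in> linear_characters G" "\<chi> \<in> linear_characters G" "\<psi> \<alpha> = \<chi> \<alpha>" "\<psi> \<beta> = \<chi> \<beta>"
  shows "\<psi> = \<chi>"
proof (rule extensionalityI)
  show "\<psi> \<in> extensional (carrier G)" "\<chi> \<in> extensional (carrier G)"
    using assms by (auto simp: linear_characters_def)
  fix x assume "x \<in> carrier G"
  thus "\<psi> x = \<chi> x"
    using assms by (auto simp: carrier_eq character_gamma character_one)
qed

text \<open>As \<gamma> is the product of \<alpha> and \<beta>, the sum factors over these two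
  generators; a factor is 2 where the characters agree and 0 where they differ.\<close>

lemma character_orthogonality:
  assumes "\<psi> \<in> linear_characters G" "\<chi> \<in> linear_characters G"
  shows "(\<Sum>g\<in>carrier G. \<psi> g * \<chi> g) = (if \<psi> = \<chi> then 4 else 0)"
proof -
  have "(\<Sum>g\<in>carrier G. \<psi> g * \<chi> g) = (1 + \<psi> \<alpha> * \<chi> \<alpha>) * (1 + \<psi> \<beta> * \<chi> \<beta>)"
    using assms by (simp add: sum_carrier character_one character_gamma algebra_simps)
  moreover have "\<psi> \<alpha> \<noteq> \<chi> \<alpha> \<or> \<psi> \<beta> \<noteq> \<chi> \<beta>" if "\<psi> \<noteq> \<chi>"
    using that assms character_eqI by blast
  ultimately show ?thesis
    using character_cases[OF assms(1), of \<alpha>] character_cases[OF assms(1), of \<beta>]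
      character_cases[OF assms(2), of \<alpha>] character_cases[OF assms(2), of \<beta>]
    by auto
qed

text \<open>Signs on the two generators can be prescribed freely; this later allows the
  autocorrelations to be separated from their character sums.\<close>

lemma ex_character:
  assumes "s \<in> {1, -1}" "t \<in> {1, -1}"
  shows "\<exists>\<psi>\<in>linear_characters G. \<psi> \<alpha> = s \<and> \<psi> \<beta> = t"
proof
  let ?\<psi> = "\<lambda>x\<in>carrier G. if x = \<alpha> then s else if x = \<beta> then t else if x = \<gamma> then s * t else 1"
  show "?\<psi> \<in> linear_characters G"
    unfolding linear_characters_def hom_def complex_units_def
    using assms distinct_carrier
    by (auto simp: multiplication_table carrier_eq)
  show "?\<psi> \<alpha> = s \<and> ?\<psi> \<beta> = t" using distinct_carrier by auto
qed

section \<open>Spectral energy and bentness in terms of autocorrelations\<close>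

lemma fourier_energy:
  assumes D: "is_dual_set G X \<phi> D" and f: "f \<in> functions_on X" and \<psi>: "\<psi> \<in> linear_characters G"
  shows "4 * of_real (\<Sum>l\<in>dual_part G X \<phi> D \<psi>. (cmod (fourier X f l))\<^sup>2)
    = of_nat (card X) * (\<Sum>g\<in>carrier G. \<psi> g * autocorrelation X (\<phi> g) f)"
proof -
  let ?n = "of_nat (card X) :: complex" and ?a = "\<lambda>l. of_real ((cmod (cinner_on X f l))\<^sup>2) :: complex"
  have n: "?n \<noteq> 0" using finite_X X_nonempty by simp
  have span: "cfun.span D = functions_on X" using D by (simp add: is_dual_set_def)
  have orth: "cinner_on X l l' = (if l = l' then ?n else 0)" if "l \<in> D" "l' \<in> D" for l l'
    using D that by (simp add: is_dual_set_def)
  have fin: "finite D"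
  proof (rule finite_independent_functions_on[OF finite_X])
    show "cfun.independent D" using D by (simp add: is_dual_set_def)
    show "D \<subseteq> functions_on X" using span cfun.span_superset by blast
  qed
  have "\<exists>\<chi>. \<forall>l\<in>D. \<chi> l \<in> linear_characters G \<and> psi_linear G X \<phi> (\<chi> l) l"
    using D by (intro bchoice) (auto simp: is_dual_set_def)
  then obtain \<chi> where \<chi>: "\<And>l. l \<in> D \<Longrightarrow> \<chi> l \<in> linear_characters G"
      "\<And>l. l \<in> D \<Longrightarrow> psi_linear G X \<phi> (\<chi> l) l" by blast
  \<comment> \<open>The inverse in \<open>psi_linear\<close> disappears because every element is its
    own inverse.\<close>
  have eigen: "l (\<phi> g x) = \<chi> l g * l x" if "g \<in> carrier G" "l \<in> D" "x \<in> X" for g l x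
    using \<chi>(2)[OF that(2)] that by (auto simp: psi_linear_def)
  \<comment> \<open>A member of \<open>D\<close> has nonzero norm, so it is nonzero somewhere, and
    there its eigenvalues determine its character.\<close>
  have part: "dual_part G X \<phi> D \<psi> = {l \<in> D. \<psi> = \<chi> l}"
  proof -
    have "\<psi> = \<chi> l" if l: "l \<in> D" and lin: "psi_linear G X \<phi> \<psi> l" for l
    proof -
      have "\<not> (\<forall>x\<in>X. l x = 0)"
      proof
        assume "\<forall>x\<in>X. l x = 0"
        hence "cinner_on X l l = 0" by (simp add: cinner_on_def)
        thus False using orth[OF l l] n by simp
      qed
      then obtain x where x: "x \<in> X" "l x \<noteq> 0" by blast
      have "\<psi> g = \<chi> l g" if "g \<in> carrier G" for g
      proof -
        have "l (\<phi> g x) = \<psi> g * l x" using lin that x by (auto simp: psi_linear_def)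
        thus ?thesis using eigen[OF that l x(1)] x(2) by simp
      qed
      thus ?thesis using \<psi> \<chi>(1)[OF l] by (intro character_eqI) auto
    qed
    thus ?thesis using \<chi>(2) by (auto simp: dual_part_def)
  qed
  \<comment> \<open>\<open>fourier\<close> pairs without a conjugate and \<open>cinner_on\<close>
    with one. Since \<psi> is real, conjugation permutes the \<psi>-part and the two energies
    agree.\<close>
  have cnj_part: "(\<lambda>x. cnj (l x)) \<in> dual_part G X \<phi> D \<psi>" if "l \<in> dual_part G X \<phi> D \<psi>" for l
  proof -
    have "cnj (\<psi> g) = \<psi> g" if "g \<in> carrier G" for g
      using character_cases[OF \<psi> that] by auto
    thus ?thesis using that D
      by (auto simp: dual_part_def psi_linear_def is_dual_set_def)
  qed
  have "(\<Sum>l\<in>dual_part G X \<phi> D \<psi>. (cmod (fourier X f l))\<^sup>2)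
      = (\<Sum>l\<in>dual_part G X \<phi> D \<psi>. (cmod (cinner_on X f l))\<^sup>2)"
    by (rule sum.reindex_bij_witness[of _ "\<lambda>l x. cnj (l x)" "\<lambda>l x. cnj (l x)"])
      (auto simp: cnj_part fourier_def cinner_on_def)
  hence "4 * of_real (\<Sum>l\<in>dual_part G X \<phi> D \<psi>. (cmod (fourier X f l))\<^sup>2)
      = (\<Sum>l\<in>dual_part G X \<phi> D \<psi>. 4 * ?a l)"
    by (simp add: sum_distrib_left)
  also have "\<dots> = (\<Sum>l\<in>D. if \<psi> = \<chi> l then 4 * ?a l else 0)"
    unfolding part using fin by (subst sum.inter_filter) auto
  \<comment> \<open>Orthogonality writes 4 times the indicator of \<open>\<psi> = \<chi> l\<close>
    as a sum over the group; after exchanging sums, the inner sum over \<open>l\<close> is an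
    autocorrelation.\<close>
  also have "\<dots> = (\<Sum>l\<in>D. (\<Sum>g\<in>carrier G. \<psi> g * \<chi> l g) * ?a l)"
    using \<psi> \<chi>(1) by (intro sum.cong) (auto simp: character_orthogonality)
  also have "\<dots> = (\<Sum>g\<in>carrier G. \<psi> g * (\<Sum>l\<in>D. \<chi> l g * ?a l))"
    unfolding sum_distrib_right sum_distrib_left by (subst sum.swap) (simp add: mult.assoc)
  also have "\<dots> = (\<Sum>g\<in>carrier G. \<psi> g * (?n * autocorrelation X (\<phi> g) f))"
  proof (intro sum.cong refl)
    fix g assume g: "g \<in> carrier G"
    have "?n * autocorrelation X (\<phi> g) f = (\<Sum>l\<in>D. \<chi> l g * ?a l)"
      by (rule autocorrelation_eigenbasis[OF fin _ n orth eigen[OF g]]) (auto simp: span f)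
    thus "\<psi> g * (\<Sum>l\<in>D. \<chi> l g * ?a l) = \<psi> g * (?n * autocorrelation X (\<phi> g) f)" by simp
  qed
  finally show ?thesis by (simp add: sum_distrib_left mult_ac)
qed

lemma bent_iff_autocorrelation:
  assumes D: "is_dual_set G X \<phi> D"
  shows "bent G X \<phi> D f \<longleftrightarrow> f \<in> functions_on X \<and> (\<forall>x\<in>X. cmod (f x) = 1) \<and>
    (\<forall>g\<in>{\<alpha>, \<beta>, \<gamma>}. autocorrelation X (\<phi> g) f = 0)"
proof (cases "f \<in> functions_on X \<and> (\<forall>x\<in>X. cmod (f x) = 1)")
  case False
  thus ?thesis by (auto simp: bent_def)
next
  case True
  let ?A = "\<lambda>g. autocorrelation X (\<phi> g) f" and ?n = "of_nat (card X) :: complex"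
  have n: "?n \<noteq> 0" using finite_X X_nonempty by simp
  have "f (\<phi> \<one> x) * cnj (f x) = 1" if "x \<in> X" for x
    using True that by (simp add: action_one complex_norm_square[symmetric])
  hence one: "?A \<one> = ?n" by (simp add: autocorrelation_def)
  \<comment> \<open>The identity element contributes \<open>card X\<close> to the character sum,
    which accounts for exactly the energy that bentness prescribes; the other three terms must
    cancel.\<close>
  have energy_iff: "(\<Sum>l\<in>dual_part G X \<phi> D \<psi>. (cmod (fourier X f l))\<^sup>2)
        = (real (card X))\<^sup>2 / real (order G)
      \<longleftrightarrow> \<psi> \<alpha> * ?A \<alpha> + \<psi> \<beta> * ?A \<beta> + \<psi> \<alpha> * \<psi> \<beta> * ?A \<gamma> = 0"
    (is "?E = _ \<longleftrightarrow> ?Z = 0") if \<psi>: "\<psi> \<in> linear_characters G" for \<psi>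
  proof -
    have "?E = (real (card X))\<^sup>2 / real (order G) \<longleftrightarrow> 4 * ?E = (real (card X))\<^sup>2"
      by (simp add: klein_four_group_order[OF klein] field_simps)
    also have "\<dots> \<longleftrightarrow> complex_of_real (4 * ?E) = of_real ((real (card X))\<^sup>2)"
      by (simp only: of_real_eq_iff)
    also have "\<dots> \<longleftrightarrow> 4 * complex_of_real ?E = ?n\<^sup>2"
      by simp
    also have "4 * complex_of_real ?E = ?n * (?n + ?Z)"
      using fourier_energy[OF D _ \<psi>, of f] True
      by (simp add: sum_carrier character_one[OF \<psi>] character_gamma[OF \<psi>] one add.assoc)
    also have "\<dots> = ?n\<^sup>2 \<longleftrightarrow> ?Z = 0"
      using n by (simp add: power2_eq_square)
    finally show ?thesis .
  qed
  have "(\<forall>\<psi>\<in>linear_characters G. \<psi> \<alpha> * ?A \<alpha> + \<psi> \<beta> * ?A \<beta> + \<psi> \<alpha> * \<psi> \<beta> * ?A \<gamma> = 0)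
      \<longleftrightarrow> ?A \<alpha> = 0 \<and> ?A \<beta> = 0 \<and> ?A \<gamma> = 0" (is "?L \<longleftrightarrow> ?R")
  proof
    assume L: ?L
    have eq: "s * ?A \<alpha> + t * ?A \<beta> + s * t * ?A \<gamma> = 0" if "s \<in> {1, -1}" "t \<in> {1, -1}" for s t
      using ex_character[OF that] L by blast
    \<comment> \<open>Three sign patterns already give a nonsingular system in the three
      autocorrelations.\<close>
    have "?A \<alpha> + ?A \<beta> + ?A \<gamma> = 0" "?A \<alpha> - ?A \<beta> - ?A \<gamma> = 0" "- ?A \<alpha> + ?A \<beta> - ?A \<gamma> = 0"
      using eq[of 1 1] eq[of 1 "-1"] eq[of "-1" 1] by auto
    thus ?R by (simp add: complex_eq_iff)
  qed auto
  thus ?thesis using True by (auto simp: bent_def energy_iff)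
qed

section \<open>Orbits of length two\<close>

lemma finite_orbits: "finite (orbits G X \<phi>)"
  using finite_X by (simp add: orbits_def)

lemma orbit_eq:
  assumes "U \<in> orbits G X \<phi>" "x \<in> U"
  shows "x \<in> X" "orbit G \<phi> x = U"
proof -
  show x: "x \<in> X" using assms orbits_coverture by blast
  have "orbit G \<phi> x \<in> orbits G X \<phi>" "x \<in> orbit G \<phi> x"
    using x orbit_refl by (auto simp: orbits_def)
  thus "orbit G \<phi> x = U" using disjoint_union[OF assms(1)] assms(2) by blast
qed

text \<open>Each group element maps the orbit injectively into itself, so on two points it is the
  identity or the swap.\<close>

lemma orbit_pair:
  assumes "U \<in> orbits G X \<phi>"
  obtains x y where "x \<in> X" "y \<in> X" "x \<noteq> y" "U = {x, y}"
    "\<forall>g\<in>carrier G. \<phi> g x = x \<and> \<phi> g y = y \<or> \<phi> g x = y \<and> \<phi> g y = x"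
    "\<exists>g\<in>carrier G. \<phi> g x = y"
proof -
  obtain x y where xy: "U = {x, y}" "x \<noteq> y"
    using card_orbit[OF assms] by (auto simp: card_2_iff)
  have X: "x \<in> X" "y \<in> X" and orb: "orbit G \<phi> x = U" "orbit G \<phi> y = U"
    using orbit_eq[OF assms] xy by auto
  have "\<phi> g x = x \<and> \<phi> g y = y \<or> \<phi> g x = y \<and> \<phi> g y = x" if "g \<in> carrier G" for g
  proof -
    have "\<phi> g x \<in> {x, y}" "\<phi> g y \<in> {x, y}" using orb xy that by (auto simp: orbit_def)
    moreover have "\<phi> g x \<noteq> \<phi> g y" using inj_prop[OF that] X xy by (auto dest: inj_onD)
    ultimately show ?thesis by auto
  qed
  moreover have "\<exists>g\<in>carrier G. \<phi> g x = y" using orb xy by (auto simp: orbit_def)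
  ultimately show ?thesis using that X xy by blast
qed

definition fixes_orbit where
  "fixes_orbit g U \<longleftrightarrow> (\<forall>x\<in>U. \<phi> g x = x)"

text \<open>The group acts on the two points through a surjection onto a group of order two, whose
  kernel has exactly one nontrivial element. Concretely, \<gamma> acts as \<alpha> after \<beta>,
  and some element moves \<open>x\<close>.\<close>

lemma fixes_orbit_cases:
  assumes "U \<in> orbits G X \<phi>"
  shows "fixes_orbit \<alpha> U \<and> \<not> fixes_orbit \<beta> U \<and> \<not> fixes_orbit \<gamma> U
    \<or> \<not> fixes_orbit \<alpha> U \<and> fixes_orbit \<beta> U \<and> \<not> fixes_orbit \<gamma> U
    \<or> \<not> fixes_orbit \<alpha> U \<and> \<not> fixes_orbit \<beta> U \<and> fixes_orbit \<gamma> U"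
proof -
  obtain x y where xy: "x \<in> X" "y \<in> X" "x \<noteq> y" "U = {x, y}"
    and pair: "\<forall>g\<in>carrier G. \<phi> g x = x \<and> \<phi> g y = y \<or> \<phi> g x = y \<and> \<phi> g y = x"
    and moved: "\<exists>g\<in>carrier G. \<phi> g x = y"
    by (rule orbit_pair[OF assms])
  have fix_iff: "fixes_orbit g U \<longleftrightarrow> \<phi> g x = x" if "g \<in> carrier G" for g
    using bspec[OF pair that] xy by (auto simp: fixes_orbit_def)
  have swap: "\<phi> g x = x \<and> \<phi> g y = y \<or> \<phi> g x = y \<and> \<phi> g y = x" if "g \<in> carrier G" for g
    using pair that by blast
  have "\<phi> \<gamma> x = \<phi> \<alpha> (\<phi> \<beta> x)"
    using composition_rule[of x \<alpha> \<beta>] xy by (simp add: multiplication_table)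
  moreover have "\<phi> \<alpha> x = y \<or> \<phi> \<beta> x = y \<or> \<phi> \<gamma> x = y"
    using moved xy action_one by (auto simp: carrier_eq)
  ultimately show ?thesis
    using swap[OF mem_carrier(1)] swap[OF mem_carrier(2)] swap[OF mem_carrier(3)] \<open>x \<noteq> y\<close>
    unfolding fix_iff[OF mem_carrier(1)] fix_iff[OF mem_carrier(2)] fix_iff[OF mem_carrier(3)]
    by auto
qed

section \<open>Correlations on orbits and the linear system\<close>

definition orbit_correlation :: "('b \<Rightarrow> complex) \<Rightarrow> 'b set \<Rightarrow> real" where
  "orbit_correlation f U = ((cmod (\<Sum>x\<in>U. f x))\<^sup>2 - 2) / 2"
  \<comment> \<open>\<open>Re (f x * cnj (f y))\<close> for \<open>U = {x, y}\<close>, written without choosing an order of the two points\<close>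

lemma orbit_correlation_pair:
  assumes "x \<noteq> y" "cmod (f x) = 1" "cmod (f y) = 1"
  shows "orbit_correlation f {x, y} = Re (f x * cnj (f y))"
proof -
  have "(Re (f x))\<^sup>2 + (Im (f x))\<^sup>2 = 1" "(Re (f y))\<^sup>2 + (Im (f y))\<^sup>2 = 1"
    using assms by (simp_all add: cmod_power2[symmetric])
  thus ?thesis
    using assms(1) by (simp add: orbit_correlation_def cmod_power2 power2_sum)
qed

lemma orbit_correlation_bound:
  assumes "U \<in> orbits G X \<phi>" "\<And>x. x \<in> X \<Longrightarrow> cmod (f x) = 1"
  shows "\<bar>orbit_correlation f U\<bar> \<le> 1"
proof -
  obtain x y where "x \<in> X" "y \<in> X" "x \<noteq> y" "U = {x, y}"
    using orbit_pair[OF assms(1)] by metis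
  thus ?thesis
    using assms(2) Re_mult_cnj_bound[of "f x" "f y"] by (simp add: orbit_correlation_pair)
qed

lemma autocorrelation_orbit:
  assumes U: "U \<in> orbits G X \<phi>" and g: "g \<in> carrier G"
    and unit: "\<And>x. x \<in> X \<Longrightarrow> cmod (f x) = 1"
  shows "autocorrelation U (\<phi> g) f
    = of_real (2 * (if fixes_orbit g U then 1 else orbit_correlation f U))"
proof -
  obtain x y where xy: "x \<in> X" "y \<in> X" "x \<noteq> y" "U = {x, y}"
    and pair: "\<forall>g\<in>carrier G. \<phi> g x = x \<and> \<phi> g y = y \<or> \<phi> g x = y \<and> \<phi> g y = x"
    and "\<exists>g\<in>carrier G. \<phi> g x = y"
    by (rule orbit_pair[OF U])
  have "f x * cnj (f x) = 1" "f y * cnj (f y) = 1"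
    using unit xy by (simp_all add: complex_norm_square[symmetric])
  \<comment> \<open>The two terms of a swapped pair are conjugate, so their sum is real and bentness
    becomes a real linear system.\<close>
  moreover have "f x * cnj (f y) + f y * cnj (f x) = of_real (2 * Re (f x * cnj (f y)))"
    by (simp add: complex_eq_iff)
  ultimately show ?thesis
    using bspec[OF pair g] xy unit
    by (auto simp: autocorrelation_def fixes_orbit_def orbit_correlation_pair add.commute)
qed

definition fixed_orbits where
  "fixed_orbits g = {U \<in> orbits G X \<phi>. fixes_orbit g U}"

text \<open>At \<alpha>, \<beta>, \<gamma> these are the sums \<open>S\<^sub>p\<close>,
  \<open>S\<^sub>q\<close>, \<open>S\<^sub>r\<close> of the opening overview.\<close>

definition fixed_correlation :: "('b \<Rightarrow> complex) \<Rightarrow> 'a \<Rightarrow> real" where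
  "fixed_correlation f g = (\<Sum>U\<in>fixed_orbits g. orbit_correlation f U)"

lemma num_trivial_orbits_eq: "num_trivial_orbits G X \<phi> g = card (fixed_orbits g)"
  by (simp add: num_trivial_orbits_def fixed_orbits_def fixes_orbit_def)

text \<open>Each orbit is fixed by exactly one of the three elements, so the three families
  partition the orbits.\<close>

lemma sum_orbits:
  "(\<Sum>U\<in>orbits G X \<phi>. h U) = (\<Sum>U\<in>fixed_orbits \<alpha>. h U) + (\<Sum>U\<in>fixed_orbits \<beta>. h U)
    + (\<Sum>U\<in>fixed_orbits \<gamma>. h U :: real)"
proof -
  have "(\<Sum>U\<in>orbits G X \<phi>. h U) = (\<Sum>U\<in>orbits G X \<phi>. (if fixes_orbit \<alpha> U then h U else 0)
      + (if fixes_orbit \<beta> U then h U else 0) + (if fixes_orbit \<gamma> U then h U else 0))"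
    using fixes_orbit_cases by (intro sum.cong refl) force
  thus ?thesis
    using finite_orbits by (simp add: sum.distrib fixed_orbits_def sum.inter_filter)
qed

lemma autocorrelation_eq:
  assumes unit: "\<And>x. x \<in> X \<Longrightarrow> cmod (f x) = 1"
  defines "S \<equiv> fixed_correlation f" and "N \<equiv> \<lambda>g. real (num_trivial_orbits G X \<phi> g)"
  shows "autocorrelation X (\<phi> \<alpha>) f = of_real (2 * (N \<alpha> + S \<beta> + S \<gamma>))"
    and "autocorrelation X (\<phi> \<beta>) f = of_real (2 * (S \<alpha> + N \<beta> + S \<gamma>))"
    and "autocorrelation X (\<phi> \<gamma>) f = of_real (2 * (S \<alpha> + S \<beta> + N \<gamma>))"
proof -
  let ?h = "\<lambda>g U. if fixes_orbit g U then 1 else orbit_correlation f U"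
  have total: "autocorrelation X (\<phi> g) f = of_real (2 * (\<Sum>U\<in>orbits G X \<phi>. ?h g U))"
    if "g \<in> carrier G" for g
  proof -
    have "autocorrelation X (\<phi> g) f = (\<Sum>U\<in>orbits G X \<phi>. autocorrelation U (\<phi> g) f)"
      by (simp add: autocorrelation_def disjoint_sum[OF finite_X])
    also have "\<dots> = (\<Sum>U\<in>orbits G X \<phi>. of_real (2 * ?h g U))"
      using autocorrelation_orbit[OF _ that unit] by (intro sum.cong) auto
    finally show ?thesis by (simp add: sum_distrib_left)
  qed
  have same: "(\<Sum>U\<in>fixed_orbits g. ?h g U) = N g" for g
    by (simp add: N_def num_trivial_orbits_eq fixed_orbits_def)
  have other: "(\<Sum>U\<in>fixed_orbits k. ?h g U) = S k"
    if "g \<in> {\<alpha>, \<beta>, \<gamma>}" "k \<in> {\<alpha>, \<beta>, \<gamma>}" "g \<noteq> k" for g k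
    unfolding S_def fixed_correlation_def
  proof (intro sum.cong refl)
    fix U assume U: "U \<in> fixed_orbits k"
    hence "\<not> fixes_orbit g U"
      using fixes_orbit_cases[of U] that by (auto simp: fixed_orbits_def)
    thus "?h g U = orbit_correlation f U" by simp
  qed
  have "(\<Sum>U\<in>orbits G X \<phi>. ?h \<alpha> U) = N \<alpha> + S \<beta> + S \<gamma>"
    "(\<Sum>U\<in>orbits G X \<phi>. ?h \<beta> U) = S \<alpha> + N \<beta> + S \<gamma>"
    "(\<Sum>U\<in>orbits G X \<phi>. ?h \<gamma> U) = S \<alpha> + S \<beta> + N \<gamma>"
    \<comment> \<open>Reversing the list supplies the inequalities in the other orientation, as the
      premises \<open>g \<noteq> k\<close> of \<open>other\<close> require.\<close>
    unfolding sum_orbits using distinct_carrier distinct_carrier[THEN distinct_rev[THEN iffD2]]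
      same[of \<alpha>] same[of \<beta>] same[of \<gamma>] other[of \<alpha> \<beta>] other[of \<alpha> \<gamma>] other[of \<beta> \<alpha>]
      other[of \<beta> \<gamma>] other[of \<gamma> \<alpha>] other[of \<gamma> \<beta>]
    by simp_all
  thus "autocorrelation X (\<phi> \<alpha>) f = of_real (2 * (N \<alpha> + S \<beta> + S \<gamma>))"
    "autocorrelation X (\<phi> \<beta>) f = of_real (2 * (S \<alpha> + N \<beta> + S \<gamma>))"
    "autocorrelation X (\<phi> \<gamma>) f = of_real (2 * (S \<alpha> + S \<beta> + N \<gamma>))"
    by (simp_all only: total mem_carrier)
qed

text \<open>Adding the three equations shows that the three sums total minus half the number of
  orbits; subtracting each equation then gives the individual sums.\<close>

lemma bent_iff_fixed_correlation:
  assumes "is_dual_set G X \<phi> D"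
  defines "N \<equiv> \<lambda>g. real (num_trivial_orbits G X \<phi> g)"
  shows "bent G X \<phi> D f \<longleftrightarrow> f \<in> functions_on X \<and> (\<forall>x\<in>X. cmod (f x) = 1) \<and>
    fixed_correlation f \<alpha> = (N \<alpha> - N \<beta> - N \<gamma>) / 2 \<and>
    fixed_correlation f \<beta> = (N \<beta> - N \<alpha> - N \<gamma>) / 2 \<and>
    fixed_correlation f \<gamma> = (N \<gamma> - N \<alpha> - N \<beta>) / 2"
proof (cases "f \<in> functions_on X \<and> (\<forall>x\<in>X. cmod (f x) = 1)")
  case True
  hence "autocorrelation X (\<phi> \<alpha>) f = 0 \<longleftrightarrow> N \<alpha> + fixed_correlation f \<beta> + fixed_correlation f \<gamma> = 0"
    "autocorrelation X (\<phi> \<beta>) f = 0 \<longleftrightarrow> fixed_correlation f \<alpha> + N \<beta> + fixed_correlation f \<gamma> = 0"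
    "autocorrelation X (\<phi> \<gamma>) f = 0 \<longleftrightarrow> fixed_correlation f \<alpha> + fixed_correlation f \<beta> + N \<gamma> = 0"
    unfolding N_def by (simp_all only: autocorrelation_eq of_real_eq_0_iff mult_eq_0_iff) simp_all
  thus ?thesis
    using True by (simp add: bent_iff_autocorrelation[OF assms(1)] field_simps) argo
qed (auto simp: bent_iff_autocorrelation[OF assms(1)])

section \<open>Attainable correlations and existence of bent functions\<close>

lemma fixed_correlation_bound:
  assumes "\<And>x. x \<in> X \<Longrightarrow> cmod (f x) = 1"
  shows "\<bar>fixed_correlation f g\<bar> \<le> real (num_trivial_orbits G X \<phi> g)"
proof -
  have "\<bar>fixed_correlation f g\<bar> \<le> (\<Sum>U\<in>fixed_orbits g. \<bar>orbit_correlation f U\<bar>)"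
    unfolding fixed_correlation_def by (rule sum_abs)
  also have "\<dots> \<le> (\<Sum>U\<in>fixed_orbits g. 1)"
    using orbit_correlation_bound assms by (intro sum_mono) (auto simp: fixed_orbits_def)
  finally show ?thesis by (simp add: num_trivial_orbits_eq)
qed

lemma ex_unit_function_with_correlations:
  assumes t: "\<And>U. U \<in> orbits G X \<phi> \<Longrightarrow> \<bar>t U\<bar> \<le> 1"
  shows "\<exists>f\<in>functions_on X. (\<forall>x\<in>X. cmod (f x) = 1) \<and>
    (\<forall>U\<in>orbits G X \<phi>. orbit_correlation f U = t U)"
proof (intro bexI conjI ballI)
  \<comment> \<open>The chosen point depends only on the orbit, so both points agree on it. It gets
    1 and the other point a unit number with real part \<open>t U\<close>; which of the two is
    chosen does not matter, since conjugation preserves real parts.\<close>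
  let ?f = "\<lambda>x. if x \<notin> X then 0
    else if x = (SOME y. y \<in> orbit G \<phi> x) then 1 else cis (arccos (t (orbit G \<phi> x)))"
  show "?f \<in> functions_on X" by (simp add: functions_on_def)
  show unit: "cmod (?f x) = 1" if "x \<in> X" for x using that by simp
  fix U assume U: "U \<in> orbits G X \<phi>"
  obtain x y where xy: "x \<in> X" "y \<in> X" "x \<noteq> y" "U = {x, y}"
    using orbit_pair[OF U] by metis
  have orb: "orbit G \<phi> x = U" "orbit G \<phi> y = U" using orbit_eq[OF U] xy by auto
  have "(SOME y. y \<in> U) \<in> {x, y}" using xy(4) by (metis insertI1 someI)
  moreover have "cos (arccos (t U)) = t U" using t[OF U] by (intro cos_arccos) auto
  ultimately have "Re (?f x * cnj (?f y)) = t U"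
    using xy(1-3) orb by auto
  thus "orbit_correlation ?f U = t U"
    unfolding xy(4) using orbit_correlation_pair[OF xy(3), of ?f] unit xy by simp
qed

lemma ex_bent:
  assumes D: "is_dual_set G X \<phi> D"
  defines "N \<equiv> \<lambda>g. real (num_trivial_orbits G X \<phi> g)"
  assumes "\<And>g. g \<in> {\<alpha>, \<beta>, \<gamma>} \<Longrightarrow> N \<alpha> + N \<beta> + N \<gamma> \<le> 4 * N g"
  shows "\<exists>f. bent G X \<phi> D f"
proof -
  \<comment> \<open>The required value of \<open>fixed_correlation\<close> at \<open>g\<close>,
    spread evenly over the \<open>N g\<close> orbits that \<open>g\<close> fixes.\<close>
  define s where "s g = (2 * N g - (N \<alpha> + N \<beta> + N \<gamma>)) / 2 / N g" for g
  define t where "t U = (if fixes_orbit \<alpha> U then s \<alpha> else if fixes_orbit \<beta> U then s \<beta> else s \<gamma>)" for U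
  have nonneg: "N g \<ge> 0" for g by (simp add: N_def)
  have "orbits G X \<phi> \<noteq> {}" using X_nonempty by (auto simp: orbits_def)
  hence "card (orbits G X \<phi>) > 0" using finite_orbits by (simp add: card_gt_0_iff)
  hence "N \<alpha> + N \<beta> + N \<gamma> > 0"
    using sum_orbits[of "\<lambda>_. 1"] by (simp add: N_def num_trivial_orbits_eq)
  \<comment> \<open>The inequality bounds a positive total by \<open>4 * N g\<close>, which makes
    the division in \<open>s\<close> legitimate.\<close>
  hence pos: "N g > 0" if "g \<in> {\<alpha>, \<beta>, \<gamma>}" for g
    using assms(3)[OF that] by linarith
  have s_bound: "\<bar>s g\<bar> \<le> 1" if "g \<in> {\<alpha>, \<beta>, \<gamma>}" for g
  proof -
    \<comment> \<open>The lower bound is the assumed inequality; the upper bound only says that the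
      total is nonnegative.\<close>
    have "\<bar>2 * N g - (N \<alpha> + N \<beta> + N \<gamma>)\<bar> \<le> 2 * N g"
      using assms(3)[OF that] nonneg[of \<alpha>] nonneg[of \<beta>] nonneg[of \<gamma>] by linarith
    thus ?thesis using pos[OF that] by (simp add: s_def abs_divide)
  qed
  hence "\<bar>t U\<bar> \<le> 1" for U by (simp add: t_def)
  then obtain f where f: "f \<in> functions_on X" "\<forall>x\<in>X. cmod (f x) = 1"
      "\<forall>U\<in>orbits G X \<phi>. orbit_correlation f U = t U"
    using ex_unit_function_with_correlations[of t] by blast
  have "fixed_correlation f g = (2 * N g - (N \<alpha> + N \<beta> + N \<gamma>)) / 2" if "g \<in> {\<alpha>, \<beta>, \<gamma>}" for g
  proof -
    have "orbit_correlation f U = s g" if U: "U \<in> fixed_orbits g" for U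
      using fixes_orbit_cases[of U] U f(3) \<open>g \<in> {\<alpha>, \<beta>, \<gamma>}\<close> by (auto simp: fixed_orbits_def t_def)
    hence "fixed_correlation f g = N g * s g"
      by (simp add: fixed_correlation_def N_def num_trivial_orbits_eq)
    thus ?thesis using pos[OF that] by (simp add: s_def)
  qed
  hence "bent G X \<phi> D f"
    using f(1,2) by (simp add: bent_iff_fixed_correlation[OF D] N_def)
  thus ?thesis by blast
qed

section \<open>Infinitely many bent functions, and necessity of the inequality\<close>

lemma bent_scale:
  assumes "is_dual_set G X \<phi> D" "bent G X \<phi> D f" "cmod c = 1"
  shows "bent G X \<phi> D (\<lambda>x. c * f x)"
proof -
  have "autocorrelation X \<sigma> (\<lambda>x. c * f x) = c * cnj c * autocorrelation X \<sigma> f" for \<sigma>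
    by (simp add: autocorrelation_def sum_distrib_left mult_ac)
  thus ?thesis
    using assms(2,3) unfolding bent_iff_autocorrelation[OF assms(1)]
    by (auto simp: functions_on_def norm_mult)
qed

lemma infinite_bent:
  assumes D: "is_dual_set G X \<phi> D" and f: "bent G X \<phi> D f"
  shows "infinite {f. bent G X \<phi> D f}"
proof -
  obtain x where x: "x \<in> X" using X_nonempty by blast
  hence fx: "f x \<noteq> 0" using f by (auto simp: bent_def)
  \<comment> \<open>On this half circle the cosine is injective, so the value at one point where
    \<open>f\<close> is nonzero recovers the angle.\<close>
  have "inj_on (\<lambda>u x. cis u * f x) {0..pi}"
  proof (rule inj_onI)
    fix u v assume uv: "u \<in> {0..pi}" "v \<in> {0..pi}" and "(\<lambda>x. cis u * f x) = (\<lambda>x. cis v * f x)"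
    hence "cis u * f x = cis v * f x" by metis
    hence "cos u = cos v" using fx by (metis cis.sel(1) mult_right_cancel)
    thus "u = v" using uv cos_inj_pi by auto
  qed
  moreover have "infinite {0..pi}" using pi_gt_zero by (simp add: infinite_Icc)
  ultimately have "infinite ((\<lambda>u x. cis u * f x) ` {0..pi})" by (simp add: finite_image_iff)
  moreover have "(\<lambda>u x. cis u * f x) ` {0..pi} \<subseteq> {f. bent G X \<phi> D f}"
    using bent_scale[OF D f] by auto
  ultimately show ?thesis using finite_subset by blast
qed

text \<open>Bentness forces the value of \<open>fixed_correlation\<close> at \<open>g\<close>;
  requiring it to be at least \<open>- N g\<close> is precisely the inequality.\<close>

lemma bent_necessary:
  assumes D: "is_dual_set G X \<phi> D" and f: "bent G X \<phi> D f" and g: "g \<in> {\<alpha>, \<beta>, \<gamma>}"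
  defines "N \<equiv> \<lambda>g. real (num_trivial_orbits G X \<phi> g)"
  shows "N \<alpha> + N \<beta> + N \<gamma> \<le> 4 * N g"
proof -
  have "\<bar>fixed_correlation f g\<bar> \<le> N g"
    unfolding N_def using f by (intro fixed_correlation_bound) (simp add: bent_def)
  moreover have "fixed_correlation f g = (2 * N g - (N \<alpha> + N \<beta> + N \<gamma>)) / 2"
    using f g by (auto simp: bent_iff_fixed_correlation[OF D] N_def)
  ultimately show ?thesis by (simp add: abs_le_iff field_simps)
qed

end

section \<open>The criterion in terms of p, q and r\<close>

theorem theorem6p2:
  fixes G :: "('a, 'm) monoid_scheme"
    and X :: "'b set"
    and \<phi> :: "'a \<Rightarrow> 'b \<Rightarrow> 'b"
    and D :: "('b \<Rightarrow> complex) set"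
    and \<alpha> \<beta> \<gamma> :: 'a
    and p q r :: nat
  assumes "klein_four_group G"
    and "carrier G = {\<one>\<^bsub>G\<^esub>, \<alpha>, \<beta>, \<gamma>}"
    and "finite X" and "X \<noteq> {}"
    and "group_action G X \<phi>"
    and "\<And>U. U \<in> orbits G X \<phi> \<Longrightarrow> card U = 2"
    and "is_dual_set G X \<phi> D"
    and "p = num_trivial_orbits G X \<phi> \<alpha>"
    and "q = num_trivial_orbits G X \<phi> \<beta>"
    and "r = num_trivial_orbits G X \<phi> \<gamma>"
  shows "(infinite {f. bent G X \<phi> D f} \<longleftrightarrow> p + q + r \<le> 4 * Min {p, q, r}) \<and>
         (\<not> p + q + r \<le> 4 * Min {p, q, r} \<longrightarrow> \<not> (\<exists>f. bent G X \<phi> D f))"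
proof -
  interpret klein_four_action G X \<phi> \<alpha> \<beta> \<gamma>
    using assms(1-6) by (simp add: klein_four_action_def klein_four_action_axioms_def)
  let ?N = "num_trivial_orbits G X \<phi>"
  \<comment> \<open>A bound by the minimum is one bound for each of the three elements, restated
    over the reals to match the lemmas on correlations.\<close>
  have ineq: "p + q + r \<le> 4 * Min {p, q, r} \<longleftrightarrow>
      (\<forall>g\<in>{\<alpha>, \<beta>, \<gamma>}. real (?N \<alpha>) + real (?N \<beta>) + real (?N \<gamma>) \<le> 4 * real (?N g))"
    unfolding assms(8-10) by auto
  have necessary: "p + q + r \<le> 4 * Min {p, q, r}" if "bent G X \<phi> D f" for f
    using bent_necessary[OF assms(7) that] by (simp only: ineq) blast
  have sufficient: "infinite {f. bent G X \<phi> D f}" if "p + q + r \<le> 4 * Min {p, q, r}"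
  proof -
    obtain f where "bent G X \<phi> D f"
      using ex_bent[OF assms(7)] \<open>p + q + r \<le> 4 * Min {p, q, r}\<close>[unfolded ineq] by meson
    thus ?thesis by (rule infinite_bent[OF assms(7)])
  qed
  show ?thesis
  proof (intro conjI iffI impI)
    assume "infinite {f. bent G X \<phi> D f}"
    then obtain f where "bent G X \<phi> D f" using not_finite_existsD by blast
    thus "p + q + r \<le> 4 * Min {p, q, r}" by (rule necessary)
  next
    assume "p + q + r \<le> 4 * Min {p, q, r}"
    thus "infinite {f. bent G X \<phi> D f}" by (rule sufficient)
  next
    assume "\<not> p + q + r \<le> 4 * Min {p, q, r}"
    thus "\<nexists>f. bent G X \<phi> D f" using necessary by blast
  qed
qed

end
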